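(* Let $F$ be a field, and let $m \geq 2$ be an integer. If $F$ is either a finite field or the field $\mathbb{R}$ of real numbers, then for any polynomial $f \in F[x_1, x_2, \ldots, x_m]$, the evaluation map $\mathrm{eva}_{f,F}: F^m\to F$ is not injective.
   Context: $F[x_1,\ldots,x_m]$ is the algebra of polynomials in $m$ commuting variables with coefficients in $F$. For $f \in F[x_1,\ldots,x_m]$, the evaluation map $\mathrm{eva}_{f,F} : F^m \to F$ is $(a_1,\ldots,a_m)\mapsto f(a_1,\ldots,a_m)$. *)

theory Defs
  imports Complex_Main "HOL-Library.Poly_Mapping" "HOL-Library.FuncSet"
begin

text \<open>
  A monomial is a finitely supported exponent vector \<open>t :: nat \<Rightarrow>\<^sub>0 nat\<close>, where \<open>lookup t i\<close> is the
  exponent of the variable \<open>x\<^sub>i\<close>, and a polynomial is a finitely supported family of coefficients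
  indexed by monomials.  The type admits all variables \<open>x\<^sub>i\<close> with \<open>i :: nat\<close>; the set \<open>mpolys m\<close>
  is the subalgebra \<open>F[x\<^sub>1, \<dots>, x\<^sub>m]\<close>.
\<close>

type_synonym 'a mpoly = "(nat \<Rightarrow>\<^sub>0 nat) \<Rightarrow>\<^sub>0 'a"

definition mpolys :: "nat \<Rightarrow> 'a::zero mpoly set" where
  "mpolys m = {f. \<forall>t \<in> Poly_Mapping.keys f. Poly_Mapping.keys t \<subseteq> {1..m}}"

definition eva :: "'a::comm_semiring_1 mpoly \<Rightarrow> (nat \<Rightarrow> 'a) \<Rightarrow> 'a" where
  "eva f a = (\<Sum>t \<in> Poly_Mapping.keys f.
     Poly_Mapping.lookup f t * (\<Prod>i \<in> Poly_Mapping.keys t. a i ^ Poly_Mapping.lookup t i))"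

text \<open>
  \<open>F\<^sup>m\<close>, with coordinates indexed by \<open>1, \<dots>, m\<close>.  Extensionality (a fixed dummy value outside
  \<open>{1..m}\<close>) makes equality of tuples coincide with equality of functions, so that injectivity
  on this set is injectivity on \<open>F\<^sup>m\<close>.
\<close>

abbreviation tuples :: "nat \<Rightarrow> (nat \<Rightarrow> 'a) set" where
  "tuples m \<equiv> {1..m} \<rightarrow>\<^sub>E UNIV"

text \<open>
  A field given by a type variable cannot be equated with the type \<open>real\<close> inside a formula, so
  being the field of real numbers is rendered as being isomorphic to it as a field; \<open>real\<close> itself
  is covered by the identity.
\<close>

definition is_real_field :: "'a::field itself \<Rightarrow> bool" where
  "is_real_field _ \<longleftrightarrow> (\<exists>\<phi> :: 'a \<Rightarrow> real. bij \<phi> \<and> \<phi> 1 = 1 \<and>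
     (\<forall>x y. \<phi> (x + y) = \<phi> x + \<phi> y) \<and> (\<forall>x y. \<phi> (x * y) = \<phi> x * \<phi> y))"

lemma is_real_field_real: "is_real_field TYPE(real)"
  unfolding is_real_field_def by (rule exI[of _ id]) simp

end

theory Submission
  imports Defs
begin

text \<open>
  Over a finite field the claim is the pigeonhole principle: \<open>q ^ m > q\<close> tuples are mapped to
  \<open>q\<close> values.

  Over the real numbers only the continuity of polynomial functions matters. Restrict the
  function to the first two coordinates, holding the others fixed, and then to the unit circle.
  By the one-dimensional case of the Borsuk--Ulam theorem, a continuous real function on the
  circle takes the same value at some pair of antipodal points, so it is not injective
  (\<open>antipodal_values_coincide\<close>). A field that is merely isomorphic to the real numbers
  carries no topology of its own; therefore the isomorphism \<open>\<phi>\<close> is applied to the values, and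
  \<open>hom_eva\<close> turns the result into a real polynomial expression in the transported coordinates.
\<close>

lemma antipodal_values_coincide:
  fixes h :: "real \<Rightarrow> real"
  assumes cont: "continuous_on UNIV h" and per: "h (2 * pi) = h 0"
  shows "\<exists>\<theta>. h \<theta> = h (\<theta> + pi)"
proof -
  define k where "k \<theta> = h \<theta> - h (\<theta> + pi)" for \<theta>
  have ck: "continuous_on {0..pi} k"
    unfolding k_def
    by (intro continuous_intros continuous_on_compose2[OF cont]) auto
  \<comment> \<open>A half turn exchanges the two antipodal points, so the difference of their values changes
    sign between \<open>0\<close> and \<open>pi\<close>.\<close>
  have "k pi = - k 0"
    using per by (simp add: k_def)
  then consider "k 0 \<le> 0" "0 \<le> k pi" | "k pi \<le> 0" "0 \<le> k 0"
    by linarith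
  then obtain \<theta> where "k \<theta> = 0"
    using IVT'[of k 0 0 pi] IVT2'[of k pi 0 0] ck by cases auto
  then show ?thesis
    by (auto simp: k_def)
qed

lemma hom_eva:
  fixes \<phi> :: "'a::field \<Rightarrow> real"
  assumes one: "\<phi> 1 = 1" and add: "\<And>x y. \<phi> (x + y) = \<phi> x + \<phi> y"
    and mult: "\<And>x y. \<phi> (x * y) = \<phi> x * \<phi> y"
  shows "\<phi> (eva f a) = (\<Sum>t \<in> Poly_Mapping.keys f.
     \<phi> (Poly_Mapping.lookup f t) *
       (\<Prod>i \<in> Poly_Mapping.keys t. \<phi> (a i) ^ Poly_Mapping.lookup t i))"
proof -
  have zero: "\<phi> 0 = 0"
    using add[of 0 0] by simp
  have sum: "\<phi> (sum g A) = (\<Sum>x\<in>A. \<phi> (g x))" for g :: "(nat \<Rightarrow>\<^sub>0 nat) \<Rightarrow> 'a" and A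
    by (induction A rule: infinite_finite_induct) (auto simp: zero add)
  have prod: "\<phi> (prod g A) = (\<Prod>x\<in>A. \<phi> (g x))" for g :: "nat \<Rightarrow> 'a" and A
    by (induction A rule: infinite_finite_induct) (auto simp: one mult)
  have power: "\<phi> (x ^ n) = \<phi> x ^ n" for x n
    by (induction n) (auto simp: one mult)
  show ?thesis
    by (simp add: eva_def sum prod power mult)
qed

lemma not_inj_on_tuples_finite:
  fixes g :: "(nat \<Rightarrow> 'a::field) \<Rightarrow> 'a"
  assumes fin: "finite (UNIV :: 'a set)" and m: "m \<ge> 2"
  shows "\<not> inj_on g (tuples m)"
proof
  assume "inj_on g (tuples m)"
  then have "card (tuples m :: (nat \<Rightarrow> 'a) set) \<le> card (UNIV :: 'a set)"
    using fin by (intro card_inj_on_le) auto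
  then have le: "card (UNIV :: 'a set) ^ m \<le> card (UNIV :: 'a set)"
    by (simp add: card_PiE)
  have "card {0, 1 :: 'a} \<le> card (UNIV :: 'a set)"
    using fin by (intro card_mono) auto
  then have "card (UNIV :: 'a set) ^ 1 < card (UNIV :: 'a set) ^ m"
    using m by (intro power_strict_increasing) auto
  with le show False
    by simp
qed

lemma not_inj_on_eva_real_field:
  fixes f :: "'a::field mpoly"
  assumes real: "is_real_field TYPE('a)" and m: "m \<ge> 2"
  shows "\<not> inj_on (eva f) (tuples m)"
proof
  assume inj: "inj_on (eva f) (tuples m)"
  from real obtain \<phi> :: "'a \<Rightarrow> real" where bij: "bij \<phi>" and one: "\<phi> 1 = 1"
    and add: "\<And>x y. \<phi> (x + y) = \<phi> x + \<phi> y" and mult: "\<And>x y. \<phi> (x * y) = \<phi> x * \<phi> y"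
    unfolding is_real_field_def by blast
  have \<phi>_inv: "\<phi> (inv \<phi> r) = r" for r
    using bij by (simp add: bij_is_surj surj_f_inv_f)
  define c :: "real \<Rightarrow> nat \<Rightarrow> 'a" where
    "c \<theta> = (\<lambda>i\<in>{1..m}. if i = 1 then inv \<phi> (cos \<theta>) else if i = 2 then inv \<phi> (sin \<theta>) else 0)"
    for \<theta>
  have c_tuples: "c \<theta> \<in> tuples m" for \<theta>
    by (auto simp: c_def)
  have c_coords: "\<phi> (c \<theta> 1) = cos \<theta>" "\<phi> (c \<theta> 2) = sin \<theta>" for \<theta>
    using m by (auto simp: c_def \<phi>_inv)
  have cont_coord: "continuous_on UNIV (\<lambda>\<theta>. \<phi> (c \<theta> i))" for i
  proof -
    consider "i = 1" | "i = 2" | "i \<noteq> 1" "i \<noteq> 2" by blast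
    then show ?thesis
    proof cases
      case 3
      then have "(\<lambda>\<theta>. \<phi> (c \<theta> i)) = (\<lambda>_. \<phi> (c 0 i))"
        by (auto simp: c_def restrict_def)
      then show ?thesis
        by (metis continuous_on_const)
    qed (simp_all only: c_coords, auto intro!: continuous_intros)
  qed
  have "continuous_on UNIV (\<lambda>\<theta>. \<phi> (eva f (c \<theta>)))"
    unfolding hom_eva[of \<phi>, OF one add mult] by (intro continuous_intros cont_coord)
  moreover have "c (2 * pi) = c 0"
    by (simp only: c_def cos_two_pi sin_two_pi cos_zero sin_zero)
  ultimately obtain \<theta> where "\<phi> (eva f (c \<theta>)) = \<phi> (eva f (c (\<theta> + pi)))"
    using antipodal_values_coincide[of "\<lambda>\<theta>. \<phi> (eva f (c \<theta>))"] by auto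
  then have "eva f (c \<theta>) = eva f (c (\<theta> + pi))"
    using bij by (simp add: bij_is_inj inj_eq)
  then have "c \<theta> = c (\<theta> + pi)"
    using inj c_tuples by (auto dest: inj_onD)
  then have "cos \<theta> = cos (\<theta> + pi)" "sin \<theta> = sin (\<theta> + pi)"
    using c_coords by metis+
  then have "cos \<theta> = 0" "sin \<theta> = 0"
    by simp_all
  then show False
    using sin_cos_squared_add[of \<theta>] by simp
qed

theorem theorem2p3:
  fixes m :: nat and f :: "'a::field mpoly"
  assumes "m \<ge> 2"
    and "finite (UNIV :: 'a set) \<or> is_real_field TYPE('a)"
    and "f \<in> mpolys m"
  shows "\<not> inj_on (eva f) (tuples m)"
  using assms(1,2) not_inj_on_tuples_finite not_inj_on_eva_real_field by blast

end
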